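(* Let $\mathcal{H}$ be a real Hilbert space and let $M_1,\dots,M_n$ be closed affine subspaces of $\mathcal{H}$ with $M:=\bigcap_{i=1}^n M_i\neq\emptyset$. Let $Q_0:=I$, $Q_i:=P_{M_i}\cdots P_{M_1}$ for $i\in\{1,\dots,n\}$, and $Q:=Q_n$. Let $x_0\in\mathcal{H}$ and let $(x_k)_{k\in\mathbb{N}}$ be a sequence generated from $x_0$ by $x_{k+1}:=x_k+t_k(Q(x_k)-x_k)$, where for each $k$ the number $t_k$ is a solution of the minimisation problem $$\min_{t\in\mathbb{R}}\bigl\|x_k+t(Q(x_k)-x_k)-P_M(x_0)\bigr\|^2 .$$ If $Q(x_k)\neq x_k$, then the solution of this minimisation problem is given by $$t_k=\frac12+\frac{\sum_{i=1}^n\|Q_{i-1}(x_k)-Q_i(x_k)\|^2}{2\|x_k-Q(x_k)\|^2}.$$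
   Context: $\|\cdot\|$ denotes the norm induced by the inner product of $\mathcal{H}$; $I$ is the identity operator; $\mathbb{N}=\{0,1,2,\dots\}$. For a nonempty closed convex set $S\subseteq\mathcal{H}$, $P_S:\mathcal{H}\to S$ denotes the nearest point projector, $P_S(x)=\arg\min_{z\in S}\|x-z\|$. *)

theory Defs
  imports "HOL-Analysis.Analysis"
begin

(* The library's closest_point is restricted to heine_borel (finite-dimensional) spaces.
   For S nonempty, closed and convex in a Hilbert space the minimiser exists and is unique,
   so the choice made by arg_min_on is irrelevant. *)
definition proj :: "'a::real_inner set \<Rightarrow> 'a \<Rightarrow> 'a" where
  "proj S x = arg_min_on (\<lambda>z. norm (x - z)) S"

(* The sets are indexed from 1; M 0 is never used. *)
primrec proj_comp :: "(nat \<Rightarrow> 'a::real_inner set) \<Rightarrow> nat \<Rightarrow> 'a \<Rightarrow> 'a" where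
  "proj_comp M 0 = id"
| "proj_comp M (Suc i) = proj (M (Suc i)) \<circ> proj_comp M i"

end

theory Submission
  imports Defs
begin

text \<open>
  For a point \<open>y\<close> of a closed affine subspace \<open>S\<close>, the projection satisfies the Pythagorean identity
  \<open>\<parallel>u - y\<parallel>\<^sup>2 = \<parallel>u - P\<^sub>S u\<parallel>\<^sup>2 + \<parallel>P\<^sub>S u - y\<parallel>\<^sup>2\<close> (\<open>proj_pythagoras\<close>). A point \<open>p\<close> common to all
  \<open>M\<^sub>i\<close> lies in each of them, so summing the identities along the chain \<open>Q\<^sub>0 x, \<dots>, Q\<^sub>n x\<close>
  telescopes to \<open>\<parallel>x - p\<parallel>\<^sup>2 = \<parallel>Q x - p\<parallel>\<^sup>2 + \<Sigma>\<close>, where \<open>\<Sigma>\<close> is the sum of the squared steps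
  (\<open>proj_comp_telescope\<close>).

  The function \<open>s \<mapsto> \<parallel>a + s d\<parallel>\<^sup>2\<close> is a quadratic polynomial with unique minimiser
  \<open>- \<langle>a, d\<rangle> / \<parallel>d\<parallel>\<^sup>2\<close> when \<open>d \<noteq> 0\<close> (\<open>is_arg_min_line_iff\<close>). With \<open>a = x - p\<close> and \<open>d = Q x - x\<close>
  the telescoped identity reads \<open>2 \<langle>a, d\<rangle> + \<parallel>d\<parallel>\<^sup>2 = - \<Sigma>\<close>, which turns the minimiser into
  \<open>1/2 + \<Sigma> / (2 \<parallel>d\<parallel>\<^sup>2)\<close>. Only the membership of \<open>p = P\<^sub>M x\<^sub>0\<close> in \<open>M\<close> matters; it holds because
  nearest points exist in nonempty closed convex subsets of a Hilbert space
  (\<open>nearest_point_exists\<close>).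
\<close>

lemma is_arg_min_line_iff:
  fixes a d :: "'a::real_inner"
  assumes "d \<noteq> 0"
  shows "is_arg_min (\<lambda>s::real. (norm (a + s *\<^sub>R d))\<^sup>2) (\<lambda>_. True) s
         \<longleftrightarrow> s = - (a \<bullet> d) / (norm d)\<^sup>2"
proof -
  define s0 where "s0 = - (a \<bullet> d) / (norm d)\<^sup>2"
  have pos: "(norm d)\<^sup>2 > 0" using assms by simp
  have s0: "a \<bullet> d = - s0 * (norm d)\<^sup>2" using pos by (simp add: s0_def)
  have eq: "(norm (a + r *\<^sub>R d))\<^sup>2 = (norm (a + s0 *\<^sub>R d))\<^sup>2 + (r - s0)\<^sup>2 * (norm d)\<^sup>2" for r
  proof -
    have expand: "(norm (a + r *\<^sub>R d))\<^sup>2 = (norm a)\<^sup>2 + 2 * r * (a \<bullet> d) + r\<^sup>2 * (norm d)\<^sup>2" for r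
      unfolding power2_norm_eq_inner
      by (simp add: inner_commute power2_eq_square algebra_simps)
    show ?thesis unfolding expand s0 by (simp add: power2_eq_square algebra_simps)
  qed
  have "is_arg_min (\<lambda>s::real. (norm (a + s *\<^sub>R d))\<^sup>2) (\<lambda>_. True) s \<longleftrightarrow> s = s0"
  proof
    assume "is_arg_min (\<lambda>s::real. (norm (a + s *\<^sub>R d))\<^sup>2) (\<lambda>_. True) s"
    then have "(norm (a + s *\<^sub>R d))\<^sup>2 \<le> (norm (a + s0 *\<^sub>R d))\<^sup>2"
      by (simp add: is_arg_min_linorder)
    then have "(s - s0)\<^sup>2 * (norm d)\<^sup>2 \<le> 0" using eq[of s] by linarith
    then show "s = s0" using pos by (simp add: mult_le_0_iff)
  next
    assume "s = s0"
    moreover have "(norm (a + s0 *\<^sub>R d))\<^sup>2 \<le> (norm (a + r *\<^sub>R d))\<^sup>2" for r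
      using eq[of r] by simp
    ultimately show "is_arg_min (\<lambda>s::real. (norm (a + s *\<^sub>R d))\<^sup>2) (\<lambda>_. True) s"
      by (simp only: is_arg_min_linorder) blast
  qed
  then show ?thesis by (simp add: s0_def)
qed

text \<open>
  A minimising sequence is Cauchy: by the parallelogram law and convexity, two points whose squared
  distances to \<open>x\<close> exceed the infimum by at most \<open>\<epsilon>\<close> and \<open>\<delta>\<close> satisfy
  \<open>\<parallel>u - v\<parallel>\<^sup>2 \<le> 2 \<epsilon> + 2 \<delta>\<close>.
\<close>

lemma nearest_point_exists:
  fixes S :: "'a::{real_inner, complete_space} set"
  assumes "closed S" "convex S" "S \<noteq> {}"
  shows "\<exists>p\<in>S. \<forall>z\<in>S. norm (x - p) \<le> norm (x - z)"
proof -
  define D where "D = (INF z\<in>S. (norm (x - z))\<^sup>2)"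
  have bdd: "bdd_below ((\<lambda>z. (norm (x - z))\<^sup>2) ` S)"
    by (rule bdd_belowI[where m = 0]) auto
  have D_le: "D \<le> (norm (x - z))\<^sup>2" if "z \<in> S" for z
    unfolding D_def by (rule cINF_lower[OF bdd that])
  have "\<exists>z\<in>S. (norm (x - z))\<^sup>2 < D + inverse (real (Suc m))" for m
  proof -
    have "D < D + inverse (real (Suc m))" by simp
    then show ?thesis
      by (simp only: cINF_less_iff[OF assms(3) bdd, folded D_def])
  qed
  then obtain w where w: "\<And>m. w m \<in> S"
    and w_lt: "\<And>m. (norm (x - w m))\<^sup>2 < D + inverse (real (Suc m))"
    by metis
  have close: "(norm (w i - w j))\<^sup>2 \<le> 2 * inverse (real (Suc i)) + 2 * inverse (real (Suc j))" for i j
  proof -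
    have "(1/2) *\<^sub>R w i + (1/2) *\<^sub>R w j \<in> S"
      using assms(2) w by (simp add: convex_def)
    from D_le[OF this]
    have mid: "D \<le> (norm (x - ((1/2) *\<^sub>R w i + (1/2) *\<^sub>R w j)))\<^sup>2" .
    have "(norm (w i - w j))\<^sup>2 + 4 * (norm (x - ((1/2) *\<^sub>R w i + (1/2) *\<^sub>R w j)))\<^sup>2
        = 2 * (norm (x - w i))\<^sup>2 + 2 * (norm (x - w j))\<^sup>2"
      by (simp add: power2_norm_eq_inner inner_commute algebra_simps)
    with mid w_lt[of i] w_lt[of j] show ?thesis by linarith
  qed
  have "Cauchy w"
  proof (rule metric_CauchyI)
    fix e :: real assume "e > 0"
    then obtain N where N: "inverse (real (Suc N)) < e\<^sup>2 / 4"
      using reals_Archimedean[of "e\<^sup>2 / 4"] by auto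
    have "dist (w i) (w j) < e" if "i \<ge> N" "j \<ge> N" for i j
    proof -
      have "inverse (real (Suc i)) \<le> inverse (real (Suc N))"
        "inverse (real (Suc j)) \<le> inverse (real (Suc N))"
        using that by (auto intro: le_imp_inverse_le)
      with close[of i j] N have "(norm (w i - w j))\<^sup>2 < e\<^sup>2" by linarith
      then show ?thesis
        using \<open>e > 0\<close> by (simp add: dist_norm power_less_imp_less_base)
    qed
    then show "\<exists>N. \<forall>i\<ge>N. \<forall>j\<ge>N. dist (w i) (w j) < e" by blast
  qed
  then obtain p where lim: "w \<longlonglongrightarrow> p"
    using Cauchy_convergent convergent_def by blast
  have p: "p \<in> S"
    using assms(1) w lim closed_sequentially by blast
  have "(norm (x - p))\<^sup>2 \<le> D + 0"
  proof (rule LIMSEQ_le)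
    show "(\<lambda>m. (norm (x - w m))\<^sup>2) \<longlonglongrightarrow> (norm (x - p))\<^sup>2"
      by (intro tendsto_intros lim)
    show "(\<lambda>m. D + inverse (real (Suc m))) \<longlonglongrightarrow> D + 0"
      by (intro tendsto_add tendsto_const LIMSEQ_inverse_real_of_nat)
    show "\<exists>N. \<forall>m\<ge>N. (norm (x - w m))\<^sup>2 \<le> D + inverse (real (Suc m))"
      using w_lt less_imp_le by blast
  qed
  then have "(norm (x - p))\<^sup>2 \<le> (norm (x - z))\<^sup>2" if "z \<in> S" for z
    using D_le[OF that] by linarith
  then have "norm (x - p) \<le> norm (x - z)" if "z \<in> S" for z
    using that power2_le_imp_le norm_ge_zero by blast
  with p show ?thesis by blast
qed

lemma proj_nearest:
  fixes S :: "'a::{real_inner, complete_space} set"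
  assumes "closed S" "convex S" "S \<noteq> {}"
  shows proj_in: "proj S x \<in> S"
    and proj_le: "z \<in> S \<Longrightarrow> norm (x - proj S x) \<le> norm (x - z)"
proof -
  obtain p where "p \<in> S" "\<forall>z\<in>S. norm (x - p) \<le> norm (x - z)"
    using nearest_point_exists[OF assms] by blast
  then have "is_arg_min (\<lambda>z. norm (x - z)) (\<lambda>z. z \<in> S) p"
    by (auto simp: is_arg_min_linorder)
  then have "is_arg_min (\<lambda>z. norm (x - z)) (\<lambda>z. z \<in> S) (proj S x)"
    unfolding proj_def arg_min_on_def arg_min_def by (rule someI)
  then show "proj S x \<in> S" "z \<in> S \<Longrightarrow> norm (x - proj S x) \<le> norm (x - z)"
    by (auto simp: is_arg_min_linorder)
qed

text \<open>
  The line through \<open>P\<^sub>S u\<close> and \<open>y\<close> stays inside \<open>S\<close>, and its point nearest to \<open>u\<close> is \<open>P\<^sub>S u\<close>,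
  which makes \<open>u - P\<^sub>S u\<close> orthogonal to it.
\<close>

lemma proj_pythagoras:
  fixes S :: "'a::{real_inner, complete_space} set"
  assumes "closed S" "affine S" "y \<in> S"
  shows "(norm (u - y))\<^sup>2 = (norm (u - proj S u))\<^sup>2 + (norm (proj S u - y))\<^sup>2"
proof -
  define p where "p = proj S u"
  have S: "closed S" "convex S" "S \<noteq> {}"
    using assms affine_imp_convex by auto
  have p: "p \<in> S" unfolding p_def by (rule proj_in[OF S])
  have "(u - p) \<bullet> (p - y) = 0"
  proof (cases "p = y")
    case False
    have "norm (u - p) \<le> norm (u - p + s *\<^sub>R (p - y))" for s
    proof -
      have "(1 - s) *\<^sub>R p + s *\<^sub>R y \<in> S"
        using assms(2,3) p by (simp add: affine_def)
      from proj_le[OF S this, of u] show ?thesis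
        by (simp add: p_def algebra_simps)
    qed
    then have "is_arg_min (\<lambda>s::real. (norm (u - p + s *\<^sub>R (p - y)))\<^sup>2) (\<lambda>_. True) 0"
      by (simp add: is_arg_min_linorder power_mono)
    with False show ?thesis
      by (subst (asm) is_arg_min_line_iff) auto
  qed simp
  moreover have "u - y = (u - p) + (p - y)" by simp
  ultimately have "(norm (u - y))\<^sup>2 = (norm (u - p))\<^sup>2 + (norm (p - y))\<^sup>2"
    by (metis norm_add_Pythagorean orthogonal_def)
  then show ?thesis by (simp add: p_def)
qed

lemma proj_comp_telescope:
  fixes M :: "nat \<Rightarrow> 'a::{real_inner, complete_space} set"
  assumes "\<And>i. i \<in> {1..n} \<Longrightarrow> affine (M i)"
    and "\<And>i. i \<in> {1..n} \<Longrightarrow> closed (M i)"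
    and "\<And>i. i \<in> {1..n} \<Longrightarrow> p \<in> M i"
  shows "(norm (u - p))\<^sup>2 = (norm (proj_comp M n u - p))\<^sup>2
         + (\<Sum>i=1..n. (norm (proj_comp M (i - 1) u - proj_comp M i u))\<^sup>2)"
  using assms
proof (induction n)
  case 0
  then show ?case by simp
next
  case (Suc n)
  have "(norm (proj_comp M n u - p))\<^sup>2
      = (norm (proj_comp M n u - proj_comp M (Suc n) u))\<^sup>2 + (norm (proj_comp M (Suc n) u - p))\<^sup>2"
    using proj_pythagoras[of "M (Suc n)" p "proj_comp M n u"] Suc.prems by simp
  moreover have "(norm (u - p))\<^sup>2 = (norm (proj_comp M n u - p))\<^sup>2
      + (\<Sum>i=1..n. (norm (proj_comp M (i - 1) u - proj_comp M i u))\<^sup>2)"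
    using Suc by simp
  ultimately show ?case by simp
qed

theorem lemma4p1:
  fixes M :: "nat \<Rightarrow> 'a::{real_inner, complete_space} set"
    and n :: nat
    and x :: "nat \<Rightarrow> 'a"
    and t :: "nat \<Rightarrow> real"
  assumes "n \<ge> 1"
    and "\<And>i. i \<in> {1..n} \<Longrightarrow> affine (M i)"
    and "\<And>i. i \<in> {1..n} \<Longrightarrow> closed (M i)"
    and "(\<Inter>i\<in>{1..n}. M i) \<noteq> {}"
    and "\<And>k. x (Suc k) = x k + t k *\<^sub>R (proj_comp M n (x k) - x k)"
    and "\<And>k. is_arg_min
           (\<lambda>s::real. (norm (x k + s *\<^sub>R (proj_comp M n (x k) - x k)
                              - proj (\<Inter>i\<in>{1..n}. M i) (x 0)))\<^sup>2)
           (\<lambda>_. True) (t k)"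
    and "proj_comp M n (x k) \<noteq> x k"
  shows "{s::real. is_arg_min
           (\<lambda>s::real. (norm (x k + s *\<^sub>R (proj_comp M n (x k) - x k)
                              - proj (\<Inter>i\<in>{1..n}. M i) (x 0)))\<^sup>2)
           (\<lambda>_. True) s} = {t k}
    \<and> t k = 1/2 + (\<Sum>i=1..n. (norm (proj_comp M (i - 1) (x k) - proj_comp M i (x k)))\<^sup>2)
                   / (2 * (norm (x k - proj_comp M n (x k)))\<^sup>2)"
proof -
  define C where "C = (\<Inter>i\<in>{1..n}. M i)"
  define p where "p = proj C (x 0)"
  define d where "d = proj_comp M n (x k) - x k"
  define \<Sigma> where "\<Sigma> = (\<Sum>i=1..n. (norm (proj_comp M (i - 1) (x k) - proj_comp M i (x k)))\<^sup>2)"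
  let ?f = "\<lambda>s::real. (norm (x k + s *\<^sub>R d - p))\<^sup>2"
  have "closed C" "convex C" "C \<noteq> {}"
    unfolding C_def using assms(2-4) by (auto intro!: convex_INT affine_imp_convex)
  then have "p \<in> C" unfolding p_def by (rule proj_in)
  then have tele: "(norm (x k - p))\<^sup>2 = (norm (proj_comp M n (x k) - p))\<^sup>2 + \<Sigma>"
    unfolding \<Sigma>_def C_def using assms(2,3) by (intro proj_comp_telescope) auto
  have "d \<noteq> 0" using assms(7) by (simp add: d_def)
  then have pos: "(norm d)\<^sup>2 > 0" by simp
  have shift: "x k + s *\<^sub>R d - p = (x k - p) + s *\<^sub>R d" for s by simp
  have min_iff: "is_arg_min ?f (\<lambda>_. True) s \<longleftrightarrow> s = - ((x k - p) \<bullet> d) / (norm d)\<^sup>2" for s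
    unfolding shift by (rule is_arg_min_line_iff[OF \<open>d \<noteq> 0\<close>])
  have tk: "is_arg_min ?f (\<lambda>_. True) (t k)"
    unfolding d_def p_def C_def by (rule assms(6))
  have "(norm (proj_comp M n (x k) - p))\<^sup>2 = (norm (x k - p + d))\<^sup>2"
    by (simp add: d_def)
  also have "\<dots> = (norm (x k - p))\<^sup>2 + 2 * ((x k - p) \<bullet> d) + (norm d)\<^sup>2"
    by (simp add: power2_norm_eq_inner inner_add_left inner_add_right inner_commute)
  finally have "- ((x k - p) \<bullet> d) = ((norm d)\<^sup>2 + \<Sigma>) / 2"
    using tele by simp
  then have "t k = 1/2 + \<Sigma> / (2 * (norm d)\<^sup>2)"
    using tk[unfolded min_iff] pos by (simp add: field_simps)
  moreover have "{s. is_arg_min ?f (\<lambda>_. True) s} = {t k}"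
    using tk by (auto simp: min_iff)
  moreover have "norm d = norm (x k - proj_comp M n (x k))"
    by (simp add: d_def norm_minus_commute)
  ultimately show ?thesis
    by (simp only: d_def p_def C_def \<Sigma>_def)
qed

end
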